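(* For every positive integer $n$, let $e_n$ denote the smallest positive integer which does not divide $n$. Let $$\ell_1 := \sum_{n \in \mathbb{N}}\frac{1}{\operatorname{lcm}(1 , 2 , \dots , n)}.$$ Then $\ell_1 < + \infty$ and, as $N \to +\infty$, $$\frac{1}{N} \sum_{n = 1}^{N} e_n = \ell_1 + O\left(\frac{(\log N)^2}{N \log\log N}\right).$$
   Context: $\mathbb{N} = \{0, 1, 2, \dots\}$ includes $0$. The least common multiple of the empty set is, by convention, equal to $1$, so the $n=0$ term of the series is $1$. $\log$ is the natural logarithm. *)

theory Defs
  imports Complex_Main "HOL-Library.Landau_Symbols"
begin

(* Only meaningful for n > 0: every positive integer divides 0. *)
definition least_nondivisor :: "nat \<Rightarrow> nat" where
  "least_nondivisor n = (LEAST k. 0 < k \<and> \<not> k dvd n)"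

(* For n = 0 the set {1..n} is empty and Lcm {} = 1. *)
definition ell1_term :: "nat \<Rightarrow> real" where
  "ell1_term n = 1 / real (Lcm {1..n})"

definition ell1 :: real where
  "ell1 = (\<Sum>n. ell1_term n)"

end

theory Submission
  imports Defs
begin

text \<open>
  Write \<open>L k\<close> for \<open>lcm(1, ..., k)\<close>. The least non-divisor of \<open>n \<ge> 1\<close> exceeds \<open>k\<close> exactly when
  \<open>1, ..., k\<close> all divide \<open>n\<close>, that is, when \<open>L k\<close> divides \<open>n\<close>; hence it equals the number of
  \<open>k \<ge> 0\<close> with \<open>L k dvd n\<close>. Exchanging the two summations, the sum of the least non-divisors up
  to \<open>N\<close> is the sum over \<open>k\<close> of \<open>\<lfloor>N / L k\<rfloor>\<close>, and its distance from \<open>N\<close> times the series is the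
  sum over \<open>k\<close> of the fractional parts of \<open>N / L k\<close>.

  Such a fractional part is at most \<open>min 1 (N / L k)\<close>, so everything rests on a lower bound for
  \<open>L k\<close>. The bound \<open>2 ^ k \<le> 2 * L k\<close> (lemma \<open>two_power_le_Lcm\<close>) comes from the Leibniz harmonic
  triangle, whose recurrence shows that \<open>(n + 1) * (n choose k)\<close> divides \<open>L (n + 1)\<close>. It makes
  the series converge, and it bounds the sum of the fractional parts by \<open>K + 4\<close> as soon as
  \<open>N \<le> 2 ^ K\<close>: the first \<open>K\<close> terms contribute at most 1 each, and the others are dominated by
  a geometric series. Choosing \<open>K\<close> close to \<open>log 2 N\<close> gives an error \<open>O(ln N / N)\<close> for the mean,
  which is stronger than the asserted bound because \<open>ln (ln N) \<le> ln N\<close>.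
\<close>

section \<open>An exponential lower bound for the least common multiple\<close>

text \<open>
  The numbers \<open>1 / ((n + 1) * (n choose k))\<close> form the Leibniz harmonic triangle: the first entry
  of row \<open>n\<close> is \<open>1 / (n + 1)\<close>, and each entry is the sum of the two below it.
\<close>

lemma leibniz_triangle_recurrence:
  assumes "k \<le> n"
  shows "1 / (real (n + 2) * real (Suc n choose Suc k)) =
         1 / (real (n + 1) * real (n choose k)) - 1 / (real (n + 2) * real (Suc n choose k))"
proof -
  define b where "b = real (n choose k)"
  have b: "b > 0" using assms by (simp add: b_def)
  have "Suc k * (Suc n choose Suc k) = Suc n * (n choose k)"
    by (rule Suc_times_binomial)
  hence 1: "real (Suc n choose Suc k) = real (n + 1) * b / real (k + 1)"
    unfolding b_def by (simp add: field_simps flip: of_nat_mult of_nat_Suc)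
  have "(Suc n - k) * (Suc n choose k) = Suc n * (n choose k)"
    using binomial_absorb_comp[of "Suc n" k] by simp
  hence "real (Suc n - k) * real (Suc n choose k) = real (n + 1) * b"
    unfolding b_def by (metis Suc_eq_plus1 of_nat_mult)
  hence 2: "real (Suc n choose k) = real (n + 1) * b / (real n + 1 - real k)"
    using assms by (simp add: field_simps of_nat_diff)
  define p q where "p = real n + 1" and "q = real n + 2"
  have pq: "p > 0" "q > 0" "p - real k > 0" using assms by (simp_all add: p_def q_def)
  have "1 / (q * (p * b / (real k + 1))) = (q - (p - real k)) / (q * (p * b))"
    by (simp add: p_def q_def)
  also have "\<dots> = 1 / (p * b) - 1 / (q * (p * b / (p - real k)))"
    using pq b by (simp add: diff_divide_distrib)
  finally show ?thesis
    unfolding 1 2 b_def[symmetric] by (simp add: p_def q_def algebra_simps)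
qed

text \<open>
  By the recurrence every entry of row \<open>n\<close> is an integer combination of \<open>1, 1/2, ..., 1/(n + 1)\<close>,
  so multiplying it by a common multiple of the denominators gives an integer.
\<close>

lemma Suc_times_binomial_dvd_Lcm:
  assumes "k \<le> n" "n < m"
  shows "Suc n * (n choose k) dvd Lcm {1..m}"
proof -
  define L where "L = real (Lcm {1..m})"
  have "L / (real (n + 1) * real (n choose k)) \<in> \<int>"
    using assms
  proof (induction k arbitrary: n)
    case 0
    have "n + 1 dvd Lcm {1..m}" using 0 by (intro dvd_Lcm) auto
    then obtain q where "Lcm {1..m} = (n + 1) * q" ..
    hence "L = real (n + 1) * real q" unfolding L_def by (metis of_nat_mult)
    thus ?case by simp
  next
    case (Suc k)
    then obtain n' where n: "n = Suc n'" "k \<le> n'" by (cases n) auto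
    have "L / (real (n + 1) * real (n choose Suc k)) =
          L / (real (n' + 1) * real (n' choose k)) - L / (real (n + 1) * real (n choose k))"
      using arg_cong[OF leibniz_triangle_recurrence[OF n(2)], of "\<lambda>x. L * x"]
      by (simp only: n(1) right_diff_distrib times_divide_eq_right mult_1_right Suc_eq_plus1
            add.assoc one_add_one)
    thus ?case using Suc.IH[of n'] Suc.IH[of n] Suc.prems n by auto
  qed
  then obtain z :: int where "L / (real (n + 1) * real (n choose k)) = of_int z"
    by (elim Ints_cases)
  hence "L = of_int z * real (Suc n * (n choose k))"
    using assms(1) by (simp add: eq_divide_eq divide_eq_eq del: of_nat_Suc) (simp add: algebra_simps)
  hence "real_of_int (int (Lcm {1..m})) = real_of_int (z * int (Suc n * (n choose k)))"
    unfolding L_def by simp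
  hence "int (Lcm {1..m}) = z * int (Suc n * (n choose k))"
    by (simp only: of_int_eq_iff)
  hence "int (Suc n * (n choose k)) dvd int (Lcm {1..m})" by simp
  thus ?thesis by (simp only: of_nat_dvd_iff)
qed

lemma Lcm_atLeastAtMost_pos: "0 < Lcm {1..n::nat}"
  by (subst neq0_conv[symmetric]) (simp add: Lcm_0_iff_nat)

text \<open>
  The \<open>n + 1\<close> numbers \<open>(n + 1) * (n choose k)\<close> all divide \<open>lcm(1, ..., n + 1)\<close>, and their average
  is \<open>2 ^ n\<close>.
\<close>

lemma two_power_le_Lcm: "2 ^ n \<le> 2 * Lcm {1..n::nat}"
proof (cases n)
  case (Suc m)
  have "Suc m * 2 ^ m = (\<Sum>k\<le>m. Suc m * (m choose k))"
    by (simp only: choose_row_sum flip: sum_distrib_left)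
  also have "\<dots> \<le> (\<Sum>k\<le>m. Lcm {1..n})"
    using Suc_times_binomial_dvd_Lcm[of _ m n] Suc Lcm_atLeastAtMost_pos
    by (intro sum_mono dvd_imp_le) auto
  also have "\<dots> = Suc m * Lcm {1..n}" by simp
  finally have "2 ^ m \<le> Lcm {1..n}" by (simp only: Suc_mult_le_cancel1)
  thus ?thesis using Suc by simp
qed simp

lemma ell1_term_le: "ell1_term n \<le> 2 * (1 / 2) ^ n"
proof -
  have "real (2 ^ n) \<le> real (2 * Lcm {1..n})"
    using two_power_le_Lcm of_nat_le_iff by blast
  thus ?thesis using Lcm_atLeastAtMost_pos[of n]
    by (simp add: ell1_term_def field_simps)
qed

lemma ell1_term_nonneg: "0 \<le> ell1_term n"
  by (simp add: ell1_term_def)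

lemma summable_ell1_term: "summable ell1_term"
  by (rule summable_comparison_test'[of "\<lambda>n. 2 * (1 / 2) ^ n" 0])
     (use ell1_term_le ell1_term_nonneg in \<open>auto intro!: summable_mult\<close>)

section \<open>Counting with least common multiples\<close>

lemma Lcm_dvd_iff_less_least_nondivisor:
  assumes "0 < n"
  shows "Lcm {1..k} dvd n \<longleftrightarrow> k < least_nondivisor n"
proof -
  let ?P = "\<lambda>j. 0 < j \<and> \<not> j dvd n"
  have "?P (Suc n)" using assms by (auto dest: dvd_imp_le)
  hence P: "?P (least_nondivisor n)" unfolding least_nondivisor_def by (rule LeastI)
  have min: "least_nondivisor n \<le> j" if "?P j" for j
    unfolding least_nondivisor_def using that by (rule Least_le)
  have "Lcm {1..k} dvd n \<longleftrightarrow> (\<forall>j\<in>{1..k}. j dvd n)"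
    by (rule Lcm_dvd_iff)
  also have "\<dots> \<longleftrightarrow> k < least_nondivisor n"
  proof
    assume "\<forall>j\<in>{1..k}. j dvd n"
    thus "k < least_nondivisor n" using P by (force simp: not_less)
  next
    assume "k < least_nondivisor n"
    hence "j < least_nondivisor n" if "j \<in> {1..k}" for j using that by simp
    thus "\<forall>j\<in>{1..k}. j dvd n"
      using min by (metis atLeastAtMost_iff less_le_trans linorder_not_less zero_less_one)
  qed
  finally show ?thesis .
qed

lemma card_multiples:
  assumes "0 < (d::nat)"
  shows "card {n \<in> {1..N}. d dvd n} = N div d"
proof -
  have "{n \<in> {1..N}. d dvd n} = (*) d ` {1..N div d}"
  proof (intro equalityI subsetI)
    fix n assume "n \<in> {n \<in> {1..N}. d dvd n}"
    then obtain q where q: "n = d * q" "1 \<le> n" "n \<le> N" by auto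
    hence "q \<in> {1..N div d}"
      using assms by (auto simp: less_eq_div_iff_mult_less_eq mult.commute Suc_le_eq)
    thus "n \<in> (*) d ` {1..N div d}" using q by blast
  next
    fix n assume "n \<in> (*) d ` {1..N div d}"
    thus "n \<in> {n \<in> {1..N}. d dvd n}"
      using assms by (auto simp: less_eq_div_iff_mult_less_eq mult.commute Suc_le_eq)
  qed
  moreover have "inj_on ((*) d) {1..N div d}" using assms by (auto simp: inj_on_def)
  ultimately show ?thesis by (simp add: card_image)
qed

lemma div_Lcm_eq_0:
  assumes "N < k"
  shows "N div Lcm {1..k::nat} = 0"
proof -
  have "k dvd Lcm {1..k}" using assms by (intro dvd_Lcm) auto
  hence "k \<le> Lcm {1..k}" using Lcm_atLeastAtMost_pos by (rule dvd_imp_le)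
  thus ?thesis using assms by simp
qed

text \<open>Double counting of the pairs \<open>(n, k)\<close> for which \<open>lcm(1, ..., k)\<close> divides \<open>n\<close>.\<close>

lemma sum_least_nondivisor:
  "(\<Sum>n=1..N. least_nondivisor n) = (\<Sum>k\<le>N. N div Lcm {1..k})"
proof -
  have "(\<Sum>n=1..N. least_nondivisor n) = (\<Sum>n=1..N. card {k \<in> {..N}. Lcm {1..k} dvd n})"
  proof (rule sum.cong[OF refl])
    fix n assume n: "n \<in> {1..N}"
    have "k \<le> N" if "Lcm {1..k} dvd n" for k
    proof (rule ccontr)
      assume "\<not> k \<le> N"
      hence "n div Lcm {1..k} = 0" using n by (intro div_Lcm_eq_0) auto
      thus False using that n by auto
    qed
    hence "{k \<in> {..N}. Lcm {1..k} dvd n} = {..<least_nondivisor n}"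
      using Lcm_dvd_iff_less_least_nondivisor[of n] n by auto
    thus "least_nondivisor n = card {k \<in> {..N}. Lcm {1..k} dvd n}" by simp
  qed
  also have "\<dots> = (\<Sum>k\<le>N. card {n \<in> {1..N}. Lcm {1..k} dvd n})"
    by (rule sum_multicount_gen) auto
  also have "\<dots> = (\<Sum>k\<le>N. N div Lcm {1..k})"
    using Lcm_atLeastAtMost_pos by (intro sum.cong refl card_multiples)
  finally show ?thesis .
qed

section \<open>The error term\<close>

text \<open>
  The difference is the sum of the fractional parts of \<open>N / lcm(1, ..., k)\<close>. The first \<open>K\<close>
  of them are bounded by 1, the others by the terms \<open>2 * N / 2 ^ k\<close> of a geometric series with
  sum \<open>4 * N / 2 ^ K \<le> 4\<close>.
\<close>

lemma sum_least_nondivisor_error: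
  assumes "N \<le> 2 ^ K"
  shows "\<bar>real N * ell1 - (\<Sum>n=1..N. real (least_nondivisor n))\<bar> \<le> real K + 4"
proof -
  define d where "d k = real N * ell1_term k - real (N div Lcm {1..k})" for k
  have floor: "\<lfloor>real N / real (Lcm {1..k})\<rfloor> = int (N div Lcm {1..k})" for k
    by (rule floor_divide_of_nat_eq)
  have d_nonneg: "0 \<le> d k" and d_le_1: "d k \<le> 1" for k
    using floor[of k] unfolding d_def ell1_term_def times_divide_eq_right mult_1_right
    by linarith+
  have d_le: "d k \<le> 2 * real N * (1 / 2) ^ k" for k
    using mult_left_mono[OF ell1_term_le[of k], of "real N"] by (simp add: d_def)
  have "(\<lambda>k. real (N div Lcm {1..k})) sums (\<Sum>k\<le>N. real (N div Lcm {1..k}))"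
    by (rule sums_finite) (use div_Lcm_eq_0 in auto)
  also have "(\<Sum>k\<le>N. real (N div Lcm {1..k})) = (\<Sum>n=1..N. real (least_nondivisor n))"
    by (simp only: sum_least_nondivisor flip: of_nat_sum)
  finally have "d sums (real N * ell1 - (\<Sum>n=1..N. real (least_nondivisor n)))"
    unfolding d_def[abs_def] ell1_def
    by (rule sums_diff[OF sums_mult[OF summable_sums[OF summable_ell1_term]]])
  hence d: "summable d" "suminf d = real N * ell1 - (\<Sum>n=1..N. real (least_nondivisor n))"
    by (auto simp: sums_iff)
  have geo: "(\<lambda>k. 2 * real N * (1 / 2) ^ K * (1 / 2) ^ k) sums (2 * real N * (1 / 2) ^ K * 2)"
    using geometric_sums[of "1 / 2 :: real"] by (intro sums_mult) simp
  have "suminf d = (\<Sum>k. d (k + K)) + (\<Sum>k<K. d k)"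
    by (rule suminf_split_initial_segment[OF d(1)])
  also have "(\<Sum>k<K. d k) \<le> real K"
    using sum_mono[of "{..<K}" d "\<lambda>_. 1"] d_le_1 by simp
  also have "(\<Sum>k. d (k + K)) \<le> 2 * real N * (1 / 2) ^ K * 2"
    unfolding sums_unique[OF geo]
    using d_le[of "_ + K"] d(1) sums_summable[OF geo]
    by (intro suminf_le) (auto simp: power_add mult_ac)
  also have "\<dots> \<le> 4"
  proof -
    have "real N \<le> real (2 ^ K)" using assms of_nat_le_iff by blast
    thus ?thesis by (simp add: field_simps)
  qed
  finally have "suminf d \<le> real K + 4" by simp
  moreover have "0 \<le> suminf d" using d(1) d_nonneg by (rule suminf_nonneg)
  ultimately show ?thesis using d(2) by simp
qed

text \<open>
  With \<open>K\<close> the rounded-up binary logarithm of \<open>N\<close>, the error \<open>K + 4\<close> is at most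
  \<open>2 * ln N + 5\<close>, and \<open>ln N \<ge> 1\<close> absorbs the constant.
\<close>

lemma sum_least_nondivisor_error_le_ln:
  assumes "3 \<le> N"
  shows "\<bar>real N * ell1 - (\<Sum>n=1..N. real (least_nondivisor n))\<bar> \<le> 7 * ln (real N)"
proof -
  have ln2: "1 / 2 \<le> ln (2::real)"
  proof -
    have "1 \<le> ln (4::real)" using exp_le by (subst ln_ge_iff) auto
    moreover have "ln (4::real) = 2 * ln 2" using ln_realpow[of 2 2] by simp
    ultimately show ?thesis by simp
  qed
  have lnN: "1 \<le> ln (real N)"
    using assms exp_le by (subst ln_ge_iff) auto
  define K where "K = nat \<lceil>log 2 (real N)\<rceil>"
  have log_pos: "0 \<le> log 2 (real N)" using assms by simp
  have "real N = 2 powr log 2 (real N)" using assms by simp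
  also have "\<dots> \<le> 2 powr real K" unfolding K_def by (intro powr_mono) linarith+
  finally have "real N \<le> real (2 ^ K)" by (simp add: powr_realpow)
  hence "N \<le> 2 ^ K" by (simp only: of_nat_le_iff)
  note sum_least_nondivisor_error[OF this]
  also have "real K \<le> log 2 (real N) + 1" unfolding K_def using log_pos by linarith
  also have "log 2 (real N) \<le> 2 * ln (real N)"
    using mult_right_mono[of 1 "2 * ln 2" "ln (real N)"] ln2 lnN
    by (simp add: log_def field_simps)
  finally show ?thesis using lnN by linarith
qed

theorem corollary1:
  shows "summable ell1_term \<and>
    (\<lambda>N::nat. (1 / real N) * (\<Sum>n=1..N. real (least_nondivisor n)) - ell1)
      \<in> O(\<lambda>N. (ln (real N))\<^sup>2 / (real N * ln (ln (real N))))"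
proof (intro conjI summable_ell1_term bigoI[where c = 7] eventually_sequentiallyI)
  (* exp 1 < 4, so from 4 on ln N exceeds 1 and ln (ln N) is positive. *)
  fix N :: nat assume N: "4 \<le> N"
  define S where "S = (\<Sum>n=1..N. real (least_nondivisor n))"
  have "exp 1 < real N" using N exp_le by linarith
  hence "ln (exp 1) < ln (real N)" using N by (subst ln_less_cancel_iff) auto
  hence lnN: "1 < ln (real N)" by simp
  hence lnln: "0 < ln (ln (real N))" "ln (ln (real N)) \<le> ln (real N)"
    using ln_bound by auto
  have "\<bar>(1 / real N) * S - ell1\<bar> = \<bar>real N * ell1 - S\<bar> / real N"
    using N by (subst abs_minus_commute) (simp add: field_simps abs_divide flip: abs_mult)
  also have "\<dots> \<le> 7 * ln (real N) / real N"
    using sum_least_nondivisor_error_le_ln[of N] N by (intro divide_right_mono) (auto simp: S_def)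
  also have "\<dots> \<le> 7 * ((ln (real N))\<^sup>2 / (real N * ln (ln (real N))))"
    using lnln lnN N by (simp add: field_simps power2_eq_square)
  also have "\<dots> \<le> 7 * norm ((ln (real N))\<^sup>2 / (real N * ln (ln (real N))))"
    unfolding real_norm_def by (intro mult_left_mono abs_ge_self) simp
  finally show "norm ((1 / real N) * (\<Sum>n=1..N. real (least_nondivisor n)) - ell1)
      \<le> 7 * norm ((ln (real N))\<^sup>2 / (real N * ln (ln (real N))))"
    unfolding S_def real_norm_def .
qed

end
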